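(* Let $X$ be a Banach space with $\dim X\ge 2$, let $0\le\alpha\le\frac12$ and $1\le p<\infty$. Then $$C^I_{NJ}(\alpha,p,X)=\frac12\,\gamma^p_X(1-2\alpha).$$
   Context: $S_X$ denotes the unit sphere of $X$. For $x_1,x_2\in X$, isosceles orthogonality $x_1\perp_I x_2$ means $\|x_1+x_2\|=\|x_1-x_2\|$. For $1\le p<\infty$ and $0\le\alpha\le\frac12$, $$C^{I}_{NJ}(\alpha,p,X)=\sup\left\{\frac{\|\alpha x_1+(1-\alpha)x_2\|^{p}+\|(1-\alpha)x_1+\alpha x_2\|^{p}}{\|x_1+x_2\|^{p}}: x_1,x_2\in X,\ (x_1,x_2)\neq(0,0),\ x_1\perp_I x_2\right\}.$$ For $1\le p<\infty$ and $0\le t\le 1$, $$\gamma^p_X(t)=\sup\left\{\frac{\|x_1+tx_2\|^p+\|x_1-tx_2\|^p}{2^{p-1}}: x_1,x_2\in S_X\right\}$$ (here $p$ in $\gamma^p_X$ is a superscript index, not a power). *)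

theory Defs
  imports "HOL-Analysis.Analysis"
begin

definition isosceles_orthogonal :: "'a::real_normed_vector \<Rightarrow> 'a \<Rightarrow> bool"  (infix "\<bottom>\<^sub>I" 50)
  where "x1 \<bottom>\<^sub>I x2 \<longleftrightarrow> norm (x1 + x2) = norm (x1 - x2)"

(* The space X is passed as TYPE('a). Both suprema are taken in the reals: the sets are bounded
   for the parameters of interest. In CNJI the denominator does not vanish, since
   x1 + x2 = 0 and isosceles orthogonality force x1 = x2 = 0. *)

definition CNJI :: "real \<Rightarrow> real \<Rightarrow> 'a::real_normed_vector itself \<Rightarrow> real"
  where "CNJI \<alpha> p X =
    Sup {(norm (\<alpha> *\<^sub>R x1 + (1 - \<alpha>) *\<^sub>R x2) powr p + norm ((1 - \<alpha>) *\<^sub>R x1 + \<alpha> *\<^sub>R x2) powr p)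
           / norm (x1 + x2) powr p
         | x1 x2 :: 'a. (x1, x2) \<noteq> (0, 0) \<and> x1 \<bottom>\<^sub>I x2}"

definition gammaX :: "real \<Rightarrow> 'a::real_normed_vector itself \<Rightarrow> real \<Rightarrow> real"
  where "gammaX p X t =
    Sup {(norm (x1 + t *\<^sub>R x2) powr p + norm (x1 - t *\<^sub>R x2) powr p) / 2 powr (p - 1)
         | x1 x2 :: 'a. x1 \<in> sphere 0 1 \<and> x2 \<in> sphere 0 1}"

(* The library's dim is 0 on infinite-dimensional spaces, so "dim X >= 2" is stated as the
   existence of two linearly independent vectors. *)

definition dim_ge_2 :: "'a::real_vector itself \<Rightarrow> bool"
  where "dim_ge_2 X \<longleftrightarrow> (\<exists>B :: 'a set. independent B \<and> card B = 2)"

end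

(* Put u = x1 + x2, v = x1 - x2 and t = 1 - 2 \<alpha>.  Isosceles orthogonality says that u and v have
   the same norm, and the two combinations in the numerator are (u - t v) / 2 and (u + t v) / 2.
   Hence, after normalising u and v, the two suprema run over the same set up to the factor 1/2. *)

theory Submission
  imports Defs
begin

text \<open>The numerator in \<open>gammaX\<close>, named because the numerator in
  \<open>CNJI\<close> also takes this form once rewritten in the sum and difference of the two
  vectors.\<close>

definition sym_power_sum :: "real \<Rightarrow> real \<Rightarrow> 'a::real_normed_vector \<Rightarrow> 'a \<Rightarrow> real"
  where "sym_power_sum p t u v = norm (u + t *\<^sub>R v) powr p + norm (u - t *\<^sub>R v) powr p"

text \<open>Both norms scale by \<open>c\<close>. This homogeneity is what lets a pair of vectors of
  equal nonzero norm be moved to the unit sphere.\<close>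

lemma sym_power_sum_scaleR:
  assumes "0 \<le> c"
  shows "sym_power_sum p t (c *\<^sub>R u) (c *\<^sub>R v) = c powr p * sym_power_sum p t u v"
proof -
  have "c *\<^sub>R u + t *\<^sub>R c *\<^sub>R v = c *\<^sub>R (u + t *\<^sub>R v)" "c *\<^sub>R u - t *\<^sub>R c *\<^sub>R v = c *\<^sub>R (u - t *\<^sub>R v)"
    by (simp_all add: algebra_simps)
  then show ?thesis
    using assms by (simp add: sym_power_sum_def powr_mult distrib_left del: scaleR_scaleR)
qed

text \<open>The triangle inequality bounds both norms by \<open>1 + t\<close>. The point is a bound
  uniform in \<open>u\<close> and \<open>v\<close>, so that the real supremum behaves as
  intended.\<close>

lemma sym_power_sum_le:
  assumes "norm u = 1" "norm v = 1" "0 \<le> t" "0 \<le> p"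
  shows "sym_power_sum p t u v \<le> 2 * (1 + t) powr p"
proof -
  have "norm (u + t *\<^sub>R v) \<le> 1 + t" "norm (u - t *\<^sub>R v) \<le> 1 + t"
    using norm_triangle_ineq[of u "t *\<^sub>R v"] norm_triangle_ineq4[of u "t *\<^sub>R v"] assms by simp_all
  then have "norm (u + t *\<^sub>R v) powr p \<le> (1 + t) powr p"
      "norm (u - t *\<^sub>R v) powr p \<le> (1 + t) powr p"
    using assms by (auto intro: powr_mono2)
  then show ?thesis
    by (simp add: sym_power_sum_def)
qed

text \<open>Twice each combination is the sum of the two vectors minus or plus
  \<open>1 - 2 * \<alpha>\<close> times their difference; the doubling produces the factor
  \<open>2 powr p\<close>.\<close>

lemma convex_combinations_power_sum:
  fixes x1 x2 :: "'a::real_normed_vector"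
  shows "norm (\<alpha> *\<^sub>R x1 + (1 - \<alpha>) *\<^sub>R x2) powr p + norm ((1 - \<alpha>) *\<^sub>R x1 + \<alpha> *\<^sub>R x2) powr p
    = sym_power_sum p (1 - 2 * \<alpha>) (x1 + x2) (x1 - x2) / 2 powr p"
proof -
  have "(x1 + x2) - (1 - 2 * \<alpha>) *\<^sub>R (x1 - x2) = 2 *\<^sub>R (\<alpha> *\<^sub>R x1 + (1 - \<alpha>) *\<^sub>R x2)"
    and "(x1 + x2) + (1 - 2 * \<alpha>) *\<^sub>R (x1 - x2) = 2 *\<^sub>R ((1 - \<alpha>) *\<^sub>R x1 + \<alpha> *\<^sub>R x2)"
    by (simp_all add: algebra_simps scaleR_2)
  then show ?thesis
    unfolding sym_power_sum_def by (simp only: norm_scaleR) (simp add: powr_mult field_simps)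
qed

lemma isosceles_quotients_eq:
  fixes \<alpha> p :: real
  shows "{(norm (\<alpha> *\<^sub>R x1 + (1 - \<alpha>) *\<^sub>R x2) powr p + norm ((1 - \<alpha>) *\<^sub>R x1 + \<alpha> *\<^sub>R x2) powr p)
           / norm (x1 + x2) powr p
         | x1 x2 :: 'a::real_normed_vector. (x1, x2) \<noteq> (0, 0) \<and> x1 \<bottom>\<^sub>I x2}
    = {sym_power_sum p (1 - 2 * \<alpha>) u v / 2 powr p
         | u v :: 'a. u \<in> sphere 0 1 \<and> v \<in> sphere 0 1}" (is "?A = ?B")
proof (intro equalityI subsetI)
  fix q assume "q \<in> ?A"
  then obtain x1 x2 :: 'a where nz: "(x1, x2) \<noteq> (0, 0)" and orth: "norm (x1 + x2) = norm (x1 - x2)"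
    and q: "q = sym_power_sum p (1 - 2 * \<alpha>) (x1 + x2) (x1 - x2) / 2 powr p / norm (x1 + x2) powr p"
    unfolding convex_combinations_power_sum isosceles_orthogonal_def by blast
  define r where "r = norm (x1 + x2)"
  \<comment> \<open>Orthogonality makes \<open>r\<close> the norm of the difference as well, so
    \<open>r = 0\<close> would annihilate both vectors.\<close>
  have "r \<noteq> 0"
  proof
    assume "r = 0"
    then have "x1 + x2 = 0" "x1 = x2"
      using orth by (simp_all add: r_def)
    then have "2 *\<^sub>R x1 = 0"
      by (simp add: scaleR_2)
    with \<open>x1 = x2\<close> nz show False
      by simp
  qed
  then have "r > 0"
    by (simp add: r_def)
  \<comment> \<open>By homogeneity, rescaling by \<open>1 / r\<close> absorbs exactly the
    denominator \<open>r powr p\<close>.\<close>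
  define u v where "u = (1 / r) *\<^sub>R (x1 + x2)" and "v = (1 / r) *\<^sub>R (x1 - x2)"
  have "norm u = 1" "norm v = 1"
    using \<open>r > 0\<close> orth by (simp_all add: u_def v_def flip: r_def)
  moreover have "q = sym_power_sum p (1 - 2 * \<alpha>) u v / 2 powr p"
    using \<open>r > 0\<close> by (simp add: q u_def v_def sym_power_sum_scaleR powr_divide flip: r_def)
  ultimately show "q \<in> ?B"
    by auto
next
  fix q assume "q \<in> ?B"
  then obtain u v :: 'a where uv: "norm u = 1" "norm v = 1"
    and q: "q = sym_power_sum p (1 - 2 * \<alpha>) u v / 2 powr p"
    by auto
  \<comment> \<open>These invert the change of variables; the denominator becomes
    \<open>norm u powr p = 1\<close>.\<close>
  define x1 x2 where "x1 = (1/2) *\<^sub>R (u + v)" and "x2 = (1/2) *\<^sub>R (u - v)"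
  have sum: "x1 + x2 = u" and diff: "x1 - x2 = v"
    by (simp_all add: x1_def x2_def flip: scaleR_right_distrib scaleR_right_diff_distrib)
  have "(x1, x2) \<noteq> (0, 0)"
    using sum uv by auto
  moreover have "x1 \<bottom>\<^sub>I x2"
    by (simp add: isosceles_orthogonal_def sum diff uv)
  moreover have "q = (norm (\<alpha> *\<^sub>R x1 + (1 - \<alpha>) *\<^sub>R x2) powr p
      + norm ((1 - \<alpha>) *\<^sub>R x1 + \<alpha> *\<^sub>R x2) powr p) / norm (x1 + x2) powr p"
    unfolding convex_combinations_power_sum by (simp add: sum diff uv q)
  ultimately show "q \<in> ?A"
    by blast
qed

text \<open>An independent set omits 0, so any of its elements can be normalised. This serves to
  show that the supremum is taken over a nonempty set.\<close>

lemma dim_ge_2_imp_unit_vector: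
  assumes "dim_ge_2 TYPE('a::real_normed_vector)"
  obtains u :: "'a::real_normed_vector" where "norm u = 1"
proof -
  obtain B :: "'a set" where "independent B" "card B = 2"
    using assms by (auto simp: dim_ge_2_def)
  have "B \<noteq> {}"
    using \<open>card B = 2\<close> by auto
  moreover have "0 \<notin> B"
    using \<open>independent B\<close> dependent_zero by blast
  ultimately obtain b where "b \<in> B" "b \<noteq> 0"
    by (metis all_not_in_conv)
  then have "norm (sgn b) = 1"
    by (simp add: norm_sgn)
  then show thesis
    by (rule that)
qed

theorem theorem1:
  fixes \<alpha> p :: real
  assumes "dim_ge_2 TYPE('a::banach)"
    and "0 \<le> \<alpha>" and "\<alpha> \<le> 1 / 2"
    and "1 \<le> p"
  shows "CNJI \<alpha> p TYPE('a) = 1 / 2 * gammaX p TYPE('a) (1 - 2 * \<alpha>)"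
proof -
  define t where "t = 1 - 2 * \<alpha>"
  define G where "G = {sym_power_sum p t u v / 2 powr (p - 1)
    | u v :: 'a. u \<in> sphere 0 1 \<and> v \<in> sphere 0 1}"
  obtain u :: 'a where "norm u = 1"
    using dim_ge_2_imp_unit_vector[OF assms(1)] .
  then have "G \<noteq> {}"
    by (auto simp: G_def)
  have "bdd_above G"
  proof (rule bdd_aboveI)
    fix g assume "g \<in> G"
    then obtain u v :: 'a where "norm u = 1" "norm v = 1"
      and g: "g = sym_power_sum p t u v / 2 powr (p - 1)"
      by (auto simp: G_def)
    \<comment> \<open>The bound requires \<open>0 \<le> t\<close>, which is where
      \<open>\<alpha> \<le> 1 / 2\<close> enters.\<close>
    then have "sym_power_sum p t u v \<le> 2 * (1 + t) powr p"
      using assms by (intro sym_power_sum_le) (auto simp: t_def)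
    then show "g \<le> 2 * (1 + t) powr p / 2 powr (p - 1)"
      unfolding g by (rule divide_right_mono) simp
  qed
  \<comment> \<open>The change of variables yields \<open>2 powr p\<close>, while
    \<open>gammaX\<close> divides by \<open>2 powr (p - 1)\<close>; this mismatch is the source of
    the factor 1/2.\<close>
  have half: "s / 2 powr p = 1 / 2 * (s / 2 powr (p - 1))" for s :: real
    by (simp add: powr_diff)
  have "{sym_power_sum p t u v / 2 powr p | u v :: 'a. u \<in> sphere 0 1 \<and> v \<in> sphere 0 1}
      = {1 / 2 * (sym_power_sum p t u v / 2 powr (p - 1))
          | u v :: 'a. u \<in> sphere 0 1 \<and> v \<in> sphere 0 1}"
    by (subst half) (rule refl)
  also have "\<dots> = (\<lambda>g. 1 / 2 * g) ` G"
    unfolding G_def by blast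
  finally have "CNJI \<alpha> p TYPE('a) = Sup ((\<lambda>g. 1 / 2 * g) ` G)"
    unfolding CNJI_def isosceles_quotients_eq t_def by (rule arg_cong)
  \<comment> \<open>Multiplication by 1/2 is monotone and continuous, hence commutes with the
    supremum of a nonempty set that is bounded above.\<close>
  also have "\<dots> = 1 / 2 * Sup G"
    using \<open>G \<noteq> {}\<close> \<open>bdd_above G\<close>
    by (intro continuous_at_Sup_mono[symmetric]) (auto intro!: monoI continuous_intros)
  also have "Sup G = gammaX p TYPE('a) t"
    by (simp add: G_def gammaX_def sym_power_sum_def)
  finally show ?thesis
    by (simp add: t_def)
qed

end
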